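(* Let $\alpha\in\{+,-\}$. A bidirected graph $G$ is a sublinear $\alpha$-radial with root $r\in V(G)$ if and only if it is a graph obtained by arbitrarily adding $(\alpha,\alpha)$-edges to an $\alpha$-flowgraph with root $r$.
   Context: A bidirected graph $G$ is a finite graph (loops and parallel edges allowed) with maps $\partial_+,\partial_-:E(G)\to 2^{V(G)}$ such that for each edge $e$ with (possibly identical) ends $u,v$: $\partial_\alpha(e)\subseteq\{u,v\}$, $\partial_+(e)\cup\partial_-(e)=\{u,v\}$, and $\partial_+(e)\cap\partial_-(e)=\emptyset$ if $e$ is not a loop. If $u\in\partial_\alpha(e)$, the sign of $u$ over $e$ is $\alpha$; $-\alpha$ denotes the opposite sign. An edge is a $(\beta,\beta)$-edge if all its ends have sign $\beta$; it is a $(+,-)$-edge if both $\partial_+(e),\partial_-(e)$ are nonempty. A bidirected graph is digraphic if every edge is a $(+,-)$-edge; it is an $\alpha$-flowgraph with root $r$ if it is digraphic and, viewed as the digraph in which each edge is an arc from its end with sign $\alpha$ to its end with sign $-\alpha$, every vertex has a directed trail to $r$. A walk is a sequence $W=(w_1,\dots,w_k)$, $k$ odd, with $w_i$ a vertex for odd $i$ and $w_i$ an edge joining $w_{i-1},w_{i+1}$ for even $i$; a trail has no repeated edge. $W$ is a diwalk if to each traversal of an edge $w_i$ one can assign signs to its end-occurrences equal to the signs of these vertices over $w_i$ (for a $(+,-)$-loop the two assigned signs are distinct), such that at every internal vertex term the signs assigned from the preceding and following edges are distinct. A ditrail is a diwalk that is a trail. For $k\ge3$ the sign of $w_1$ (resp.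 $w_k$) over $W$ is the sign assigned at $w_2$ (resp. $w_{k-1}$); $W$ is an $(\alpha,\beta)$-ditrail if these are $\alpha,\beta$, and an $\alpha$-ditrail if it is an $(\alpha,\beta)$-ditrail for some $\beta$; the trivial ditrail $(v)$ counts as both a $(+,-)$- and a $(-,+)$-ditrail. $G$ is an $\alpha$-radial with root $r$ if every $v$ has an $(\alpha,-\alpha)$-ditrail from $v$ to $r$, and an $\alpha$-semiradial with root $r$ if every $v$ has an $\alpha$-ditrail from $v$ to $r$. An $\alpha$-semiradial is sublinear if there is no $(-\alpha,-\alpha)$-ditrail from any vertex to $r$; a sublinear $\alpha$-radial is a sublinear $\alpha$-semiradial that is an $\alpha$-radial. *)

theory Defs
  imports "Graph_Theory.Arc_Walk"
begin

datatype sign = Plus | Minus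

fun opp :: "sign \<Rightarrow> sign" where
  "opp Plus = Minus"
| "opp Minus = Plus"

text \<open>
  A bidirected graph has named edges, so parallel edges are allowed; \<open>bends G e\<close> is the set of ends
  of \<open>e\<close>, a singleton if \<open>e\<close> is a loop, and \<open>bd G \<alpha> e\<close> is the set of ends of sign \<open>\<alpha>\<close> over \<open>e\<close>.
  The values of \<open>bends\<close> and \<open>bd\<close> outside \<open>bedges G\<close> are irrelevant.
\<close>

record ('v, 'e) bidigraph =
  bverts :: "'v set"
  bedges :: "'e set"
  bends :: "'e \<Rightarrow> 'v set"
  bd :: "sign \<Rightarrow> 'e \<Rightarrow> 'v set"

definition bidirected_graph :: "('v, 'e) bidigraph \<Rightarrow> bool" where
  "bidirected_graph G \<longleftrightarrow> finite (bverts G) \<and> finite (bedges G) \<and>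
     (\<forall>e \<in> bedges G. \<exists>u \<in> bverts G. \<exists>v \<in> bverts G.
        bends G e = {u, v} \<and>
        bd G Plus e \<subseteq> {u, v} \<and> bd G Minus e \<subseteq> {u, v} \<and>
        bd G Plus e \<union> bd G Minus e = {u, v} \<and>
        (u \<noteq> v \<longrightarrow> bd G Plus e \<inter> bd G Minus e = {}))"

text \<open>
  The second conjunct only matters for loops: a loop whose single vertex carries both signs is a
  \<open>(+,-)\<close>-edge and not a \<open>(\<beta>,\<beta>)\<close>-edge.
\<close>

definition same_sign_edge :: "('v, 'e) bidigraph \<Rightarrow> sign \<Rightarrow> 'e \<Rightarrow> bool" where
  "same_sign_edge G \<beta> e \<longleftrightarrow> bd G \<beta> e = bends G e \<and> bd G (opp \<beta>) e = {}"

definition mixed_edge :: "('v, 'e) bidigraph \<Rightarrow> 'e \<Rightarrow> bool" where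
  "mixed_edge G e \<longleftrightarrow> bd G Plus e \<noteq> {} \<and> bd G Minus e \<noteq> {}"

definition digraphic :: "('v, 'e) bidigraph \<Rightarrow> bool" where
  "digraphic G \<longleftrightarrow> bidirected_graph G \<and> (\<forall>e \<in> bedges G. mixed_edge G e)"

text \<open>
  In a digraphic graph, \<open>bd G \<alpha> e\<close> and \<open>bd G (opp \<alpha>) e\<close> are singletons for every edge \<open>e\<close>.
\<close>

definition digraph_view :: "sign \<Rightarrow> ('v, 'e) bidigraph \<Rightarrow> ('v, 'e) pre_digraph" where
  "digraph_view \<alpha> G =
     \<lparr> verts = bverts G, arcs = bedges G,
       tail = \<lambda>e. the_elem (bd G \<alpha> e), head = \<lambda>e. the_elem (bd G (opp \<alpha>) e) \<rparr>"

definition flowgraph :: "sign \<Rightarrow> ('v, 'e) bidigraph \<Rightarrow> 'v \<Rightarrow> bool" where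
  "flowgraph \<alpha> G r \<longleftrightarrow> digraphic G \<and> r \<in> bverts G \<and>
     (\<forall>v \<in> bverts G. \<exists>p. pre_digraph.trail (digraph_view \<alpha> G) v p r)"

text \<open>
  A walk \<open>(w\<^sub>1, \<dots>, w\<^sub>k)\<close> is represented by the list \<open>vs\<close> of its vertex terms and the list \<open>es\<close> of its
  edge terms; the edge \<open>es ! i\<close> is traversed from \<open>vs ! i\<close> to \<open>vs ! Suc i\<close>.
\<close>

definition bd_walk :: "('v, 'e) bidigraph \<Rightarrow> 'v list \<Rightarrow> 'e list \<Rightarrow> bool" where
  "bd_walk G vs es \<longleftrightarrow>
     length vs = Suc (length es) \<and> set vs \<subseteq> bverts G \<and> set es \<subseteq> bedges G \<and>
     (\<forall>i < length es. bends G (es ! i) = {vs ! i, vs ! Suc i})"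

definition bd_trail :: "('v, 'e) bidigraph \<Rightarrow> 'v list \<Rightarrow> 'e list \<Rightarrow> bool" where
  "bd_trail G vs es \<longleftrightarrow> bd_walk G vs es \<and> distinct es"

text \<open>
  \<open>ss ! i = (a, b)\<close> assigns the sign \<open>a\<close> to \<open>vs ! i\<close> and the sign \<open>b\<close> to \<open>vs ! Suc i\<close> for the
  traversal of \<open>es ! i\<close>. Only traversals of \<open>(+,-)\<close>-loops leave a choice.
\<close>

definition signing ::
    "('v, 'e) bidigraph \<Rightarrow> 'v list \<Rightarrow> 'e list \<Rightarrow> (sign \<times> sign) list \<Rightarrow> bool" where
  "signing G vs es ss \<longleftrightarrow>
     length ss = length es \<and>
     (\<forall>i < length es.
        vs ! i \<in> bd G (fst (ss ! i)) (es ! i) \<and>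
        vs ! Suc i \<in> bd G (snd (ss ! i)) (es ! i) \<and>
        (vs ! i = vs ! Suc i \<and> mixed_edge G (es ! i) \<longrightarrow> fst (ss ! i) \<noteq> snd (ss ! i))) \<and>
     (\<forall>i. Suc i < length es \<longrightarrow> snd (ss ! i) \<noteq> fst (ss ! Suc i))"

definition diwalk :: "('v, 'e) bidigraph \<Rightarrow> 'v list \<Rightarrow> 'e list \<Rightarrow> bool" where
  "diwalk G vs es \<longleftrightarrow> bd_walk G vs es \<and> (\<exists>ss. signing G vs es ss)"

definition ditrail :: "('v, 'e) bidigraph \<Rightarrow> 'v list \<Rightarrow> 'e list \<Rightarrow> bool" where
  "ditrail G vs es \<longleftrightarrow> diwalk G vs es \<and> bd_trail G vs es"

text \<open>
  The trivial ditrail counts as both a \<open>(+,-)\<close>- and a \<open>(-,+)\<close>-ditrail. A ditrail consisting of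
  \<open>(+,-)\<close>-loops only has two signings and therefore also counts as both.
\<close>

definition signed_ditrail ::
    "('v, 'e) bidigraph \<Rightarrow> sign \<Rightarrow> sign \<Rightarrow> 'v list \<Rightarrow> 'e list \<Rightarrow> bool" where
  "signed_ditrail G \<alpha> \<beta> vs es \<longleftrightarrow> ditrail G vs es \<and>
     (if es = [] then \<alpha> \<noteq> \<beta>
      else \<exists>ss. signing G vs es ss \<and> fst (hd ss) = \<alpha> \<and> snd (last ss) = \<beta>)"

definition ditrail_between ::
    "('v, 'e) bidigraph \<Rightarrow> sign \<Rightarrow> sign \<Rightarrow> 'v \<Rightarrow> 'v \<Rightarrow> bool" where
  "ditrail_between G \<alpha> \<beta> u v \<longleftrightarrow>
     (\<exists>vs es. signed_ditrail G \<alpha> \<beta> vs es \<and> hd vs = u \<and> last vs = v)"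

definition radial :: "sign \<Rightarrow> ('v, 'e) bidigraph \<Rightarrow> 'v \<Rightarrow> bool" where
  "radial \<alpha> G r \<longleftrightarrow> bidirected_graph G \<and> r \<in> bverts G \<and>
     (\<forall>v \<in> bverts G. ditrail_between G \<alpha> (opp \<alpha>) v r)"

definition semiradial :: "sign \<Rightarrow> ('v, 'e) bidigraph \<Rightarrow> 'v \<Rightarrow> bool" where
  "semiradial \<alpha> G r \<longleftrightarrow> bidirected_graph G \<and> r \<in> bverts G \<and>
     (\<forall>v \<in> bverts G. \<exists>\<beta>. ditrail_between G \<alpha> \<beta> v r)"

definition sublinear_semiradial :: "sign \<Rightarrow> ('v, 'e) bidigraph \<Rightarrow> 'v \<Rightarrow> bool" where
  "sublinear_semiradial \<alpha> G r \<longleftrightarrow> semiradial \<alpha> G r \<and>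
     \<not> (\<exists>v \<in> bverts G. ditrail_between G (opp \<alpha>) (opp \<alpha>) v r)"

definition sublinear_radial :: "sign \<Rightarrow> ('v, 'e) bidigraph \<Rightarrow> 'v \<Rightarrow> bool" where
  "sublinear_radial \<alpha> G r \<longleftrightarrow> sublinear_semiradial \<alpha> G r \<and> radial \<alpha> G r"

text \<open>\<open>G\<close> arises from \<open>F\<close> by adding any (possibly empty) set of \<open>(\<alpha>,\<alpha>)\<close>-edges.\<close>

definition adds_same_sign_edges ::
    "sign \<Rightarrow> ('v, 'e) bidigraph \<Rightarrow> ('v, 'e) bidigraph \<Rightarrow> bool" where
  "adds_same_sign_edges \<alpha> F G \<longleftrightarrow>
     bidirected_graph F \<and> bidirected_graph G \<and>
     bverts G = bverts F \<and> bedges F \<subseteq> bedges G \<and>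
     (\<forall>e \<in> bedges F. bends G e = bends F e \<and> (\<forall>\<beta>. bd G \<beta> e = bd F \<beta> e)) \<and>
     (\<forall>e \<in> bedges G - bedges F. same_sign_edge G \<alpha> e)"

end

theory Submission
  imports Defs
begin

text \<open>
  Both directions rest on sign propagation. In a graph without \<open>(-\<alpha>,-\<alpha>)\<close>-edges, a ditrail
  leaving a vertex with sign \<open>-\<alpha>\<close> traverses every edge from \<open>-\<alpha>\<close> to \<open>\<alpha>\<close> and so cannot end with
  \<open>-\<alpha>\<close>; this gives sublinearity of a flowgraph with added \<open>(\<alpha>,\<alpha>)\<close>-edges. Conversely, every
  suffix of a ditrail is a ditrail, so in a sublinear \<open>\<alpha>\<close>-radial an \<open>(\<alpha>,-\<alpha>)\<close>-ditrail to the
  root leaves each of its vertices with sign \<open>\<alpha>\<close>, hence enters each with sign \<open>-\<alpha>\<close>, and is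
  a directed trail. Finally, a \<open>(-\<alpha>,-\<alpha>)\<close>-edge \<open>e\<close> either occurs on the ditrail from one of its
  ends to the root, whose suffix from \<open>e\<close> on is then a \<open>(-\<alpha>,-\<alpha>)\<close>-ditrail, or can be prepended to
  it.
\<close>

section \<open>Signs at the ends of a single edge\<close>

lemma neq_sign_iff: "a \<noteq> b \<longleftrightarrow> a = opp b"
  by (cases a; cases b) auto

lemma opp_neq [simp]: "opp a \<noteq> a" "a \<noteq> opp a"
  by (cases a; simp)+

lemma bd_endsD:
  assumes "bidirected_graph G" "e \<in> bedges G"
  shows "bd G a e \<union> bd G (opp a) e = bends G e"
    and "bends G e \<subseteq> bverts G"
    and "\<exists>u v. bends G e = {u, v}"
    and "bd G a e \<inter> bd G (opp a) e = {} \<or> (\<exists>u. bends G e = {u})"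
proof -
  obtain u v where uv: "u \<in> bverts G" "v \<in> bverts G" "bends G e = {u, v}"
      "bd G Plus e \<union> bd G Minus e = {u, v}"
      "u \<noteq> v \<longrightarrow> bd G Plus e \<inter> bd G Minus e = {}"
    using assms unfolding bidirected_graph_def by metis
  then show "bd G a e \<union> bd G (opp a) e = bends G e" by (cases a) auto
  show "bends G e \<subseteq> bverts G" "\<exists>u v. bends G e = {u, v}" using uv by auto
  show "bd G a e \<inter> bd G (opp a) e = {} \<or> (\<exists>u. bends G e = {u})"
    using uv by (cases "u = v"; cases a) auto
qed

lemma mixed_edge_iff: "mixed_edge G e \<longleftrightarrow> bd G a e \<noteq> {} \<and> bd G (opp a) e \<noteq> {}"
  by (cases a) (auto simp: mixed_edge_def)

text \<open>At a non-loop the opposite sign occupies one of the two ends, leaving only one for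
  \<open>a\<close>; a loop has a single end anyway. This is what makes \<open>the_elem\<close> in
  \<open>digraph_view\<close> return a determined vertex.\<close>

lemma mixed_edge_bd_singleton:
  assumes "bidirected_graph G" "e \<in> bedges G" "mixed_edge G e" "x \<in> bd G a e"
  shows "bd G a e = {x}"
proof -
  obtain u v where uv: "bends G e = {u, v}"
    using bd_endsD(3)[OF assms(1,2)] by blast
  obtain y where y: "y \<in> bd G (opp a) e"
    using assms(3) by (auto simp: mixed_edge_iff[of _ _ a])
  note ends = bd_endsD(1,4)[OF assms(1,2), of a]
  show ?thesis
    using ends(2)
  proof
    assume "bd G a e \<inter> bd G (opp a) e = {}"
    then have "y \<noteq> x" "y \<notin> bd G a e" "bd G a e \<subseteq> {u, v}" "y \<in> {u, v}"
      using y assms(4) ends(1) uv by auto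
    then show ?thesis using assms(4) by auto
  next
    assume "\<exists>u. bends G e = {u}"
    then obtain w where "bd G a e \<subseteq> {w}" using ends(1) by (metis Un_upper1)
    then show ?thesis using assms(4) by blast
  qed
qed

lemma not_mixed_edge_cases:
  assumes "bidirected_graph G" "e \<in> bedges G" "\<not> mixed_edge G e"
  obtains b where "b = a \<or> b = opp a" "same_sign_edge G b e"
proof -
  have "bd G a e = {} \<or> bd G (opp a) e = {}"
    using assms(3) by (simp add: mixed_edge_iff[of _ _ a])
  moreover have "opp (opp a) = a" by (cases a) auto
  ultimately have "same_sign_edge G a e \<or> same_sign_edge G (opp a) e"
    using bd_endsD(1)[OF assms(1,2), of a] by (auto simp: same_sign_edge_def)
  then show thesis using that by blast
qed

text \<open>Equal signs at distinct ends would put both ends into one singleton of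
  \<open>mixed_edge_bd_singleton\<close>. At a loop the last hypothesis, which has the form of the
  loop clause of \<open>signing\<close>, decides.\<close>

lemma mixed_edge_signs_neq:
  assumes "bidirected_graph G" "e \<in> bedges G" "mixed_edge G e" "bends G e = {x, y}"
    and "x \<in> bd G a e" "y \<in> bd G b e" "x = y \<longrightarrow> a \<noteq> b"
  shows "a \<noteq> b"
proof
  assume "a = b"
  then have "bd G a e = {x}" "x \<noteq> y" "y \<in> bd G a e"
    using assms mixed_edge_bd_singleton by metis+
  then show False by auto
qed

section \<open>Suffixes and one-edge extensions of ditrails\<close>

lemma ditrail_suffix:
  assumes "ditrail G vs es" "signing G vs es ss" "i < length es"
  shows "ditrail_between G (fst (ss ! i)) (snd (last ss)) (vs ! i) (last vs)"
proof -
  have len: "length vs = Suc (length es)" "length ss = length es"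
    using assms by (auto simp: ditrail_def diwalk_def bd_walk_def signing_def)
  have sg: "signing G (drop i vs) (drop i es) (drop i ss)"
    using assms(2,3) len by (auto simp: signing_def)
  have "bd_walk G (drop i vs) (drop i es)"
    using assms len set_drop_subset[of i vs] set_drop_subset[of i es]
    by (auto simp: ditrail_def diwalk_def bd_walk_def)
  moreover have "distinct (drop i es)"
    using assms by (auto simp: ditrail_def bd_trail_def)
  ultimately have "ditrail G (drop i vs) (drop i es)"
    using sg by (auto simp: ditrail_def diwalk_def bd_trail_def)
  then show ?thesis
    using sg assms(3) len
    unfolding ditrail_between_def signed_ditrail_def
    by (intro exI[of _ "drop i vs"] exI[of _ "drop i es"])
       (auto simp: hd_drop_conv_nth intro!: exI[of _ "drop i ss"])
qed

lemma ditrail_edge: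
  assumes "bidirected_graph G" "e \<in> bedges G" "bends G e = {u, v}" "u \<in> bd G a e" "v \<in> bd G b e"
    and "u = v \<and> mixed_edge G e \<longrightarrow> a \<noteq> b"
  shows "signed_ditrail G a b [u, v] [e]"
proof -
  have "signing G [u, v] [e] [(a, b)]"
    using assms by (auto simp: signing_def)
  moreover have "bd_walk G [u, v] [e]"
    using assms(2,3) bd_endsD(2)[OF assms(1,2)] by (auto simp: bd_walk_def)
  ultimately show ?thesis
    by (auto simp: signed_ditrail_def ditrail_def diwalk_def bd_trail_def
        intro!: exI[of _ "[(a, b)]"])
qed

text \<open>The hypothesis \<open>b \<noteq> fst (hd ss)\<close> is the diwalk condition at
  \<open>hd vs\<close>, which becomes an internal vertex. A trivial ditrail carries no sign there;
  that case is \<open>ditrail_edge\<close>.\<close>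

lemma ditrail_Cons:
  assumes "bidirected_graph G" "e \<in> bedges G" "bends G e = {u, hd vs}"
    and "u \<in> bd G a e" "hd vs \<in> bd G b e" "u = hd vs \<and> mixed_edge G e \<longrightarrow> a \<noteq> b"
    and "ditrail G vs es" "signing G vs es ss" "es \<noteq> []" "b \<noteq> fst (hd ss)" "e \<notin> set es"
  shows "signed_ditrail G a (snd (last ss)) (u # vs) (e # es)"
proof -
  have vs: "vs \<noteq> []" "length ss = length es" "ss \<noteq> []"
    using assms by (auto simp: ditrail_def diwalk_def bd_walk_def signing_def)
  have "signing G (u # vs) (e # es) ((a, b) # ss)"
    using assms vs by (auto simp: signing_def nth_Cons hd_conv_nth split: nat.splits)
  moreover have "bd_walk G (u # vs) (e # es)"
    using assms(2,3,7) vs bd_endsD(2)[OF assms(1,2)]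
    by (auto simp: ditrail_def diwalk_def bd_walk_def nth_Cons hd_conv_nth split: nat.splits)
  moreover have "distinct (e # es)"
    using assms by (auto simp: ditrail_def bd_trail_def)
  ultimately show ?thesis
    using vs by (auto simp: signed_ditrail_def ditrail_def diwalk_def bd_trail_def
        intro!: exI[of _ "(a, b) # ss"])
qed

section \<open>Edges and signs in a sublinear radial\<close>

lemma sublinear_radial_no_opp_edge:
  assumes "sublinear_radial \<alpha> G r" "e \<in> bedges G"
  shows "\<not> same_sign_edge G (opp \<alpha>) e"
proof
  assume "same_sign_edge G (opp \<alpha>) e"
  moreover have "opp (opp \<alpha>) = \<alpha>" by (cases \<alpha>) auto
  ultimately have e: "bd G (opp \<alpha>) e = bends G e" "bd G \<alpha> e = {}"
    by (auto simp: same_sign_edge_def)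
  have nm: "\<not> mixed_edge G e" using e by (simp add: mixed_edge_iff[of _ _ \<alpha>])
  have G: "bidirected_graph G"
    and rad: "\<And>v. v \<in> bverts G \<Longrightarrow> ditrail_between G \<alpha> (opp \<alpha>) v r"
    and sub: "\<And>v. v \<in> bverts G \<Longrightarrow> \<not> ditrail_between G (opp \<alpha>) (opp \<alpha>) v r"
    using assms by (auto simp: sublinear_radial_def sublinear_semiradial_def radial_def)
  obtain u v where uv: "bends G e = {u, v}"
    using bd_endsD(3)[OF G assms(2)] by blast
  have V: "u \<in> bverts G" "v \<in> bverts G"
    using bd_endsD(2)[OF G assms(2)] uv by auto
  obtain vs es where P: "signed_ditrail G \<alpha> (opp \<alpha>) vs es" "hd vs = v" "last vs = r"
    using rad[OF V(2)] by (auto simp: ditrail_between_def)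
  have D: "ditrail G vs es" using P by (simp add: signed_ditrail_def)
  have len: "length vs = Suc (length es)"
    using D by (auto simp: ditrail_def diwalk_def bd_walk_def)
  show False
  proof (cases "es = []")
    case True
    \<comment> \<open>Here the edge \<open>e\<close> alone is the forbidden ditrail, from
      \<open>u\<close> to \<open>v = r\<close>.\<close>
    then have "v = r" using P len by (cases vs) auto
    moreover have "signed_ditrail G (opp \<alpha>) (opp \<alpha>) [u, v] [e]"
      by (rule ditrail_edge) (use G assms(2) uv e nm in auto)
    ultimately have "ditrail_between G (opp \<alpha>) (opp \<alpha>) u r"
      unfolding ditrail_between_def by fastforce
    then show False using sub V by blast
  next
    case False
    then obtain ss where ss: "signing G vs es ss" "fst (hd ss) = \<alpha>" "snd (last ss) = opp \<alpha>"
      using P by (auto simp: signed_ditrail_def)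
    show False
    proof (cases "e \<in> set es")
      case True
      then obtain i where i: "i < length es" "es ! i = e" by (auto simp: in_set_conv_nth)
      have "vs ! i \<in> bd G (fst (ss ! i)) e" using ss i by (auto simp: signing_def)
      \<comment> \<open>No end of \<open>e\<close> has sign \<alpha>, so the suffix beginning with
        \<open>e\<close> starts with \<open>opp \<alpha>\<close>.\<close>
      then have "fst (ss ! i) = opp \<alpha>" using e neq_sign_iff by fastforce
      then have "ditrail_between G (opp \<alpha>) (opp \<alpha>) (vs ! i) r"
        using ditrail_suffix[OF D ss(1) i(1)] P ss by simp
      moreover have "vs ! i \<in> bverts G"
        using D i len by (auto simp: ditrail_def diwalk_def bd_walk_def)
      ultimately show False using sub by blast
    next
      case nin: False
      \<comment> \<open>Entering \<open>v\<close> through \<open>e\<close> with sign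
        \<open>opp \<alpha>\<close> fits, since the chosen ditrail leaves \<open>v\<close> with
        \<alpha>.\<close>
      have "signed_ditrail G (opp \<alpha>) (snd (last ss)) (u # vs) (e # es)"
        by (rule ditrail_Cons[where b = "opp \<alpha>"])
           (use G assms(2) uv e nm D ss False nin P in auto)
      then have "ditrail_between G (opp \<alpha>) (opp \<alpha>) u r"
        unfolding ditrail_between_def using ss P len
        by (intro exI[of _ "u # vs"] exI[of _ "e # es"]) auto
      then show False using sub V by blast
    qed
  qed
qed

text \<open>A first sign \<open>opp \<alpha>\<close> at any index would make the suffix from there a
  forbidden ditrail to \<open>r\<close>. So all first signs are \<alpha>; each second sign is then
  forced by the first sign of the next edge, and the last one is given.\<close>

lemma sublinear_ditrail_signs:
  assumes "sublinear_semiradial \<alpha> G r" "ditrail G vs es" "signing G vs es ss" "last vs = r"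
    and "snd (last ss) = opp \<alpha>" "i < length es"
  shows "ss ! i = (\<alpha>, opp \<alpha>)"
proof -
  have len: "length vs = Suc (length es)" "length ss = length es"
    using assms by (auto simp: ditrail_def diwalk_def bd_walk_def signing_def)
  have fst: "fst (ss ! j) = \<alpha>" if "j < length es" for j
  proof (rule ccontr)
    assume "fst (ss ! j) \<noteq> \<alpha>"
    then have "ditrail_between G (opp \<alpha>) (opp \<alpha>) (vs ! j) r"
      using ditrail_suffix[OF assms(2,3) that] assms neq_sign_iff by simp
    moreover have "vs ! j \<in> bverts G"
      using assms(2) that len by (auto simp: ditrail_def diwalk_def bd_walk_def)
    ultimately show False using assms(1) by (auto simp: sublinear_semiradial_def)
  qed
  have "snd (ss ! i) = opp \<alpha>"
  proof (cases "Suc i < length es")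
    case True
    then show ?thesis using assms(3) fst[OF True] neq_sign_iff by (auto simp: signing_def)
  next
    case False
    then have "last ss = ss ! i" using assms(6) len by (cases ss rule: rev_cases) (auto simp: nth_append)
    then show ?thesis using assms(5) by simp
  qed
  then show ?thesis using fst[OF assms(6)] by (simp add: prod_eq_iff)
qed

section \<open>Passing between directed trails and ditrails\<close>

lemma (in pre_digraph) cas_hd_last:
  assumes "length vs = Suc (length es)"
    and "\<And>i. i < length es \<Longrightarrow> tail G (es ! i) = vs ! i"
    and "\<And>i. i < length es \<Longrightarrow> head G (es ! i) = vs ! Suc i"
  shows "cas (hd vs) es (last vs)"
  using assms
proof (induction es arbitrary: vs)
  case Nil
  then show ?case by (cases vs) auto
next
  case (Cons e es)
  obtain x xs where vs: "vs = x # xs" "length xs = Suc (length es)"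
    using Cons.prems(1) by (cases vs) auto
  then have "xs \<noteq> []" by auto
  have "cas (hd xs) es (last xs)"
    by (rule Cons.IH) (use vs Cons.prems(2,3)[of "Suc i" for i] in auto)
  then show ?case
    using Cons.prems(2,3)[of 0] vs \<open>xs \<noteq> []\<close> by (auto simp: hd_conv_nth)
qed

text \<open>Together with \<open>cas_last\<close>, this identifies \<open>u # map (head G) p\<close>
  as the vertex list of an arc chain: each entry after the first is the head of the preceding
  arc.\<close>

lemma (in pre_digraph) cas_nth:
  assumes "cas u p v" "i < length p"
  shows "tail G (p ! i) = (u # map (head G) p) ! i"
  using assms
  by (induction p arbitrary: u i) (auto simp: nth_Cons split: nat.splits)

lemma (in pre_digraph) cas_last:
  "cas u p v \<Longrightarrow> last (u # map (head G) p) = v"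
  by (induction p arbitrary: u) (auto split: if_splits)

text \<open>By \<open>sublinear_ditrail_signs\<close>, the ditrail to \<open>r\<close> runs through
  each edge from \<alpha> to \<open>opp \<alpha>\<close>. Hence it uses only (+,-)-edges, survives
  deletion of the others, and follows the orientation of \<open>digraph_view\<close>.\<close>

lemma sublinear_radial_mixed_trail:
  assumes "sublinear_radial \<alpha> G r" "v \<in> bverts G"
  shows "\<exists>p. pre_digraph.trail
    (digraph_view \<alpha> (G\<lparr>bedges := {e \<in> bedges G. mixed_edge G e}\<rparr>)) v p r"
    (is "\<exists>p. pre_digraph.trail ?D v p r")
proof -
  have G: "bidirected_graph G" and sub: "sublinear_semiradial \<alpha> G r"
    and "ditrail_between G \<alpha> (opp \<alpha>) v r"
    using assms by (auto simp: sublinear_radial_def radial_def)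
  then obtain vs es where P: "signed_ditrail G \<alpha> (opp \<alpha>) vs es" "hd vs = v" "last vs = r"
    by (auto simp: ditrail_between_def)
  have D: "ditrail G vs es" using P by (simp add: signed_ditrail_def)
  have W: "length vs = Suc (length es)" "set vs \<subseteq> bverts G" "set es \<subseteq> bedges G" "distinct es"
    using D by (auto simp: ditrail_def diwalk_def bd_walk_def bd_trail_def)
  have bd: "vs ! i \<in> bd G \<alpha> (es ! i)" "vs ! Suc i \<in> bd G (opp \<alpha>) (es ! i)" if "i < length es" for i
  proof -
    have "es \<noteq> []" using that by auto
    then obtain ss where ss: "signing G vs es ss" "snd (last ss) = opp \<alpha>"
      using P by (auto simp: signed_ditrail_def)
    then show "vs ! i \<in> bd G \<alpha> (es ! i)" "vs ! Suc i \<in> bd G (opp \<alpha>) (es ! i)"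
      using sublinear_ditrail_signs[OF sub D ss(1) P(3) ss(2) that] that
      by (auto simp: signing_def dest!: spec[of _ i])
  qed
  have mixed: "mixed_edge G (es ! i)" if "i < length es" for i
    using bd[OF that] by (auto simp: mixed_edge_iff[of _ _ \<alpha>])
  \<comment> \<open>Membership is sharpened to singletons so that \<open>the_elem\<close> returns
    these vertices as tail and head.\<close>
  have sing: "bd G \<alpha> (es ! i) = {vs ! i}" "bd G (opp \<alpha>) (es ! i) = {vs ! Suc i}"
    if "i < length es" for i
    using mixed_edge_bd_singleton[OF G _ mixed[OF that]] bd[OF that] W(3) that
    by (auto simp: subset_iff)
  have "pre_digraph.cas ?D (hd vs) es (last vs)"
    by (rule pre_digraph.cas_hd_last) (use W sing in \<open>auto simp: digraph_view_def\<close>)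
  moreover have "set es \<subseteq> {e \<in> bedges G. mixed_edge G e}"
    using W(3) mixed by (auto simp: in_set_conv_nth)
  ultimately show ?thesis
    using P assms(2) W(4)
    by (auto simp: pre_digraph.trail_def pre_digraph.awalk_def digraph_view_def)
qed

lemma flowgraph_ditrail:
  assumes "flowgraph \<alpha> F r" "adds_same_sign_edges \<alpha> F G" "v \<in> bverts G"
  shows "ditrail_between G \<alpha> (opp \<alpha>) v r"
proof -
  let ?D = "digraph_view \<alpha> F"
  have F: "bidirected_graph F" and mixed: "\<And>e. e \<in> bedges F \<Longrightarrow> mixed_edge F e"
    using assms by (auto simp: flowgraph_def digraphic_def)
  have FG: "bverts G = bverts F" "bedges F \<subseteq> bedges G"
      "\<And>e. e \<in> bedges F \<Longrightarrow> bends G e = bends F e"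
      "\<And>e b. e \<in> bedges F \<Longrightarrow> bd G b e = bd F b e"
    using assms(2) by (auto simp: adds_same_sign_edges_def)
  obtain p where "pre_digraph.trail ?D v p r"
    using assms FG by (auto simp: flowgraph_def)
  then have p: "set p \<subseteq> bedges F" "distinct p" "pre_digraph.cas ?D v p r"
    by (auto simp: pre_digraph.trail_def pre_digraph.awalk_def digraph_view_def)
  \<comment> \<open>\<open>cas\<close> works with arcs only; this restores the vertex terms of the
    walk.\<close>
  define vs where "vs = v # map (head ?D) p"
  have last: "last vs = r" and len: "length vs = Suc (length p)"
    using pre_digraph.cas_last[OF p(3)] by (auto simp: vs_def)
  have bd: "bd F \<alpha> (p ! i) = {vs ! i}" "bd F (opp \<alpha>) (p ! i) = {vs ! Suc i}" "p ! i \<in> bedges F"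
    if "i < length p" for i
  proof -
    show e: "p ! i \<in> bedges F" using p that by auto
    obtain x y where "bd F \<alpha> (p ! i) = {x}" "bd F (opp \<alpha>) (p ! i) = {y}"
      using mixed_edge_bd_singleton[OF F e mixed[OF e]] mixed[OF e]
      by (metis mixed_edge_iff ex_in_conv)
    moreover have "tail ?D (p ! i) = vs ! i" "head ?D (p ! i) = vs ! Suc i"
      using pre_digraph.cas_nth[OF p(3) that] that by (auto simp: vs_def)
    ultimately show "bd F \<alpha> (p ! i) = {vs ! i}" "bd F (opp \<alpha>) (p ! i) = {vs ! Suc i}"
      by (auto simp: digraph_view_def)
  qed
  have ends: "bends F (p ! i) = {vs ! i, vs ! Suc i}" if "i < length p" for i
    using bd_endsD(1)[OF F bd(3)[OF that], of \<alpha>] bd[OF that] by auto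
  have "vs ! i \<in> bverts G" if "i < length vs" for i
  proof (cases i)
    case 0
    then show ?thesis using assms by (simp add: vs_def)
  next
    case (Suc j)
    then have "j < length p" using that len by simp
    then show ?thesis
      using ends[of j] bd_endsD(2)[OF F bd(3)[of j]] FG(1) Suc by auto
  qed
  then have "set vs \<subseteq> bverts G" by (auto simp: in_set_conv_nth)
  then have "bd_walk G vs p"
    using ends bd(3) FG len p by (auto simp: bd_walk_def)
  \<comment> \<open>A constant signing alternates: each arc ends with \<open>opp \<alpha>\<close>
    and the next one starts with \<alpha>. Loops get distinct signs as well.\<close>
  moreover have sg: "signing G vs p (replicate (length p) (\<alpha>, opp \<alpha>))"
    using bd FG by (auto simp: signing_def)
  ultimately have "ditrail G vs p"
    using p by (auto simp: ditrail_def diwalk_def bd_trail_def)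
  then have "signed_ditrail G \<alpha> (opp \<alpha>) vs p"
    using sg by (auto simp: signed_ditrail_def intro!: exI[of _ "replicate (length p) (\<alpha>, opp \<alpha>)"])
  then show ?thesis
    using last unfolding ditrail_between_def by (auto simp: vs_def)
qed

section \<open>Sign propagation in the absence of edges with both signs opposite to \<alpha>\<close>

lemma no_opp_opp_ditrail:
  assumes "bidirected_graph G"
    and "\<And>e. e \<in> bedges G \<Longrightarrow> mixed_edge G e \<or> same_sign_edge G \<alpha> e"
  shows "\<not> ditrail_between G (opp \<alpha>) (opp \<alpha>) u v"
proof
  assume "ditrail_between G (opp \<alpha>) (opp \<alpha>) u v"
  \<comment> \<open>The trivial ditrail is ruled out because it requires two different end
    signs.\<close>
  then obtain vs es ss where W: "bd_walk G vs es" and "es \<noteq> []"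
    and ss: "signing G vs es ss" "fst (hd ss) = opp \<alpha>" "snd (last ss) = opp \<alpha>"
    by (auto simp: ditrail_between_def signed_ditrail_def ditrail_def bd_trail_def split: if_splits)
  have len: "length ss = length es" using ss by (simp add: signing_def)
  have step: "snd (ss ! i) = \<alpha>" if i: "i < length es" "fst (ss ! i) = opp \<alpha>" for i
  proof -
    have e: "es ! i \<in> bedges G" "bends G (es ! i) = {vs ! i, vs ! Suc i}"
      using W i by (auto simp: bd_walk_def)
    have s: "vs ! i \<in> bd G (opp \<alpha>) (es ! i)" "vs ! Suc i \<in> bd G (snd (ss ! i)) (es ! i)"
        "vs ! i = vs ! Suc i \<and> mixed_edge G (es ! i) \<longrightarrow> opp \<alpha> \<noteq> snd (ss ! i)"
      using ss(1) i by (auto simp: signing_def dest!: spec[of _ i])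
    \<comment> \<open>An (\<alpha>,\<alpha>)-edge has no end of sign \<open>opp \<alpha>\<close>, so
      it cannot be left with that sign.\<close>
    have m: "mixed_edge G (es ! i)"
      using assms(2)[OF e(1)] s(1) by (auto simp: same_sign_edge_def)
    then have "opp \<alpha> \<noteq> snd (ss ! i)"
      using mixed_edge_signs_neq[OF assms(1) e(1) m e(2) s(1,2)] s(3) by blast
    then show ?thesis by (cases \<alpha>; cases "snd (ss ! i)") auto
  qed
  \<comment> \<open>By \<open>step\<close> the traversal ends with \<alpha>, so alternation makes
    the next one start with \<open>opp \<alpha>\<close> again.\<close>
  have "i < length es \<Longrightarrow> fst (ss ! i) = opp \<alpha>" for i
  proof (induction i)
    case 0
    then show ?case using ss len by (simp add: hd_conv_nth flip: length_greater_0_conv)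
  next
    case (Suc i)
    then have "\<alpha> \<noteq> fst (ss ! Suc i)" using step[of i] ss(1) by (auto simp: signing_def)
    then show ?case using neq_sign_iff by metis
  qed
  then have "snd (ss ! (length es - 1)) = \<alpha>" using step \<open>es \<noteq> []\<close> by simp
  moreover have "ss \<noteq> []" using len \<open>es \<noteq> []\<close> by auto
  ultimately show False using ss(3) len by (simp add: last_conv_nth)
qed

theorem theorem11p12:
  fixes G :: "('v, 'e) bidigraph" and r :: 'v and \<alpha> :: sign
  assumes "bidirected_graph G" and "r \<in> bverts G"
  shows "sublinear_radial \<alpha> G r \<longleftrightarrow>
    (\<exists>F :: ('v, 'e) bidigraph. flowgraph \<alpha> F r \<and> adds_same_sign_edges \<alpha> F G)"
proof
  assume S: "sublinear_radial \<alpha> G r"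
  \<comment> \<open>This edge set is forced: a flowgraph has only (+,-)-edges, and an added edge is
    never one.\<close>
  let ?F = "G\<lparr>bedges := {e \<in> bedges G. mixed_edge G e}\<rparr>"
  have F: "bidirected_graph ?F"
    using assms(1) by (auto simp: bidirected_graph_def)
  then have "flowgraph \<alpha> ?F r"
    using sublinear_radial_mixed_trail[OF S] assms(2)
    by (auto simp: flowgraph_def digraphic_def mixed_edge_def)
  moreover have "same_sign_edge G \<alpha> e" if "e \<in> bedges G" "\<not> mixed_edge G e" for e
    using not_mixed_edge_cases[OF assms(1) that, of \<alpha>] sublinear_radial_no_opp_edge[OF S that(1)]
    by metis
  then have "adds_same_sign_edges \<alpha> ?F G"
    using F assms(1) by (auto simp: adds_same_sign_edges_def)
  ultimately show "\<exists>F :: ('v, 'e) bidigraph. flowgraph \<alpha> F r \<and> adds_same_sign_edges \<alpha> F G"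
    by blast
next
  assume "\<exists>F :: ('v, 'e) bidigraph. flowgraph \<alpha> F r \<and> adds_same_sign_edges \<alpha> F G"
  then obtain F :: "('v, 'e) bidigraph"
    where F: "flowgraph \<alpha> F r" "adds_same_sign_edges \<alpha> F G" by blast
  have rad: "ditrail_between G \<alpha> (opp \<alpha>) v r" if "v \<in> bverts G" for v
    using flowgraph_ditrail[OF F that] .
  \<comment> \<open>Edges of \<open>F\<close> keep their signs in \<open>G\<close>, hence remain
    (+,-)-edges; all others were added.\<close>
  have "mixed_edge G e \<or> same_sign_edge G \<alpha> e" if "e \<in> bedges G" for e
    using F that by (auto simp: flowgraph_def digraphic_def adds_same_sign_edges_def mixed_edge_def)
  then have "\<not> ditrail_between G (opp \<alpha>) (opp \<alpha>) v r" for v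
    using no_opp_opp_ditrail[OF assms(1)] by blast
  then show "sublinear_radial \<alpha> G r"
    using assms rad
    by (auto simp: sublinear_radial_def sublinear_semiradial_def semiradial_def radial_def)
qed

end
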